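(* Let $\alpha,\beta\in\mathbb{R}$ and $\delta,\varepsilon>0$ satisfy $\alpha\neq\beta$ and $(\alpha-\beta)\delta+\varepsilon^2-\delta^2\neq0$, and let $\mathcal{E}=\{e^{(1)},\dots,e^{(12)}\}$ be the set of transformation strains of monoclinic-I martensite with these lattice parameters. If $\varepsilon=\delta$, then the convex hull of $\mathcal{E}$ has exactly 7 four-dimensional facets, namely the convex hulls of $\{e^{(i)}: i\in I\}$ for the following index sets $I$: (1) 4 facets with 9 vertices each: $\{1,2,3,5,7,8,9,10,12\}$, $\{1,2,4,5,6,8,9,11,12\}$, $\{1,3,4,5,6,7,9,10,11\}$, $\{2,3,4,6,7,8,10,11,12\}$; (2) 3 facets with 8 vertices each, each with index set invariant under $r_0$: $\{1,2,3,4,5,6,7,8\}$, $\{1,2,3,4,9,10,11,12\}$, $\{5,6,7,8,9,10,11,12\}$.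
   Context: Write $M(a,b,c;p,q,s)$ for the real symmetric $3\times 3$ matrix with diagonal entries $a,b,c$, $(1,2)$-entry $p$, $(1,3)$-entry $q$ and $(2,3)$-entry $s$. The twelve transformation strains of monoclinic-I martensite with lattice parameters $\alpha,\beta,\delta,\varepsilon$ are $e^{(1)}=M(\alpha,\alpha,\beta;\delta,\varepsilon,\varepsilon)$, $e^{(2)}=M(\alpha,\alpha,\beta;\delta,-\varepsilon,-\varepsilon)$, $e^{(3)}=M(\alpha,\alpha,\beta;-\delta,-\varepsilon,\varepsilon)$, $e^{(4)}=M(\alpha,\alpha,\beta;-\delta,\varepsilon,-\varepsilon)$, $e^{(5)}=M(\alpha,\beta,\alpha;\varepsilon,\delta,\varepsilon)$, $e^{(6)}=M(\alpha,\beta,\alpha;-\varepsilon,\delta,-\varepsilon)$, $e^{(7)}=M(\alpha,\beta,\alpha;-\varepsilon,-\delta,\varepsilon)$, $e^{(8)}=M(\alpha,\beta,\alpha;\varepsilon,-\delta,-\varepsilon)$, $e^{(9)}=M(\beta,\alpha,\alpha;\varepsilon,\varepsilon,\delta)$, $e^{(10)}=M(\beta,\alpha,\alpha;-\varepsilon,-\varepsilon,\delta)$, $e^{(11)}=M(\beta,\alpha,\alpha;-\varepsilon,\varepsilon,-\delta)$, $e^{(12)}=M(\beta,\alpha,\alpha;\varepsilon,-\varepsilon,-\delta)$. The convex hull of $\mathcal{E}$ is a five-dimensional polytope (in the affine space of symmetric matrices of trace $2\alpha+\beta$); its facets are its extreme subsets (faces) of codimension one. $r_0$ is the permutation of $\{1,\dots,12\}$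 interchanging $1\leftrightarrow2$, $3\leftrightarrow4$, $5\leftrightarrow6$, $7\leftrightarrow8$, $9\leftrightarrow10$, $11\leftrightarrow12$. *)

theory Defs
  imports "HOL-Analysis.Analysis" "HOL-Combinatorics.Transposition"
begin

text \<open>Arguments in the order: diagonal entries, then entries (1,2), (1,3), (2,3).\<close>

definition symm_mat :: "real \<Rightarrow> real \<Rightarrow> real \<Rightarrow> real \<Rightarrow> real \<Rightarrow> real \<Rightarrow> real^3^3" where
  "symm_mat a b c p q s =
     vector [vector [a, p, q],
             vector [p, b, s],
             vector [q, s, c]]"

text \<open>Strains are numbered from 1 as in the literature; only indices in \<open>{1..12}\<close> are meaningful.\<close>

definition strain :: "real \<Rightarrow> real \<Rightarrow> real \<Rightarrow> real \<Rightarrow> nat \<Rightarrow> real^3^3" where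
  "strain \<alpha> \<beta> \<delta> \<epsilon> i =
     [symm_mat \<alpha> \<alpha> \<beta>   \<delta>    \<epsilon>    \<epsilon>,
      symm_mat \<alpha> \<alpha> \<beta>   \<delta>  (-\<epsilon>) (-\<epsilon>),
      symm_mat \<alpha> \<alpha> \<beta> (-\<delta>) (-\<epsilon>)   \<epsilon>,
      symm_mat \<alpha> \<alpha> \<beta> (-\<delta>)   \<epsilon>  (-\<epsilon>),
      symm_mat \<alpha> \<beta> \<alpha>   \<epsilon>    \<delta>    \<epsilon>,
      symm_mat \<alpha> \<beta> \<alpha> (-\<epsilon>)   \<delta>  (-\<epsilon>),
      symm_mat \<alpha> \<beta> \<alpha> (-\<epsilon>) (-\<delta>)   \<epsilon>,
      symm_mat \<alpha> \<beta> \<alpha>   \<epsilon>  (-\<delta>) (-\<epsilon>),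
      symm_mat \<beta> \<alpha> \<alpha>   \<epsilon>    \<epsilon>    \<delta>,
      symm_mat \<beta> \<alpha> \<alpha> (-\<epsilon>) (-\<epsilon>)   \<delta>,
      symm_mat \<beta> \<alpha> \<alpha> (-\<epsilon>)   \<epsilon>  (-\<delta>),
      symm_mat \<beta> \<alpha> \<alpha>   \<epsilon>  (-\<epsilon>) (-\<delta>)] ! (i - 1)"

definition strains :: "real \<Rightarrow> real \<Rightarrow> real \<Rightarrow> real \<Rightarrow> (real^3^3) set" where
  "strains \<alpha> \<beta> \<delta> \<epsilon> = strain \<alpha> \<beta> \<delta> \<epsilon> ` {1..12}"

definition strain_hull :: "real \<Rightarrow> real \<Rightarrow> real \<Rightarrow> real \<Rightarrow> nat set \<Rightarrow> (real^3^3) set" where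
  "strain_hull \<alpha> \<beta> \<delta> \<epsilon> I = convex hull (strain \<alpha> \<beta> \<delta> \<epsilon> ` I)"

definition r0 :: "nat \<Rightarrow> nat" where
  "r0 = Transposition.transpose 1 2 \<circ> Transposition.transpose 3 4 \<circ> Transposition.transpose 5 6 \<circ>
        Transposition.transpose 7 8 \<circ> Transposition.transpose 9 10 \<circ> Transposition.transpose 11 12"

definition index_sets_9 :: "nat set set" where
  "index_sets_9 =
     {{1,2,3,5,7,8,9,10,12}, {1,2,4,5,6,8,9,11,12},
      {1,3,4,5,6,7,9,10,11}, {2,3,4,6,7,8,10,11,12}}"

definition index_sets_8 :: "nat set set" where
  "index_sets_8 =
     {{1,2,3,4,5,6,7,8}, {1,2,3,4,9,10,11,12}, {5,6,7,8,9,10,11,12}}"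

end

theory Submission
  imports Defs
begin

text \<open>
  When \<open>\<epsilon> = \<delta>\<close>, the off-diagonal triples \<open>(p, q, s)\<close> occurring in each of the three families of four
  strains are the same: they are the four sign patterns \<open>(\<plusminus>\<delta>, \<plusminus>\<delta>, \<plusminus>\<delta>)\<close> with positive product, that is,
  the vertices of a regular tetrahedron. The three possible diagonals, with \<open>\<beta>\<close> in one position and
  \<open>\<alpha> \<noteq> \<beta>\<close> in the other two, are the vertices of a triangle, and all twelve combinations of a diagonal
  and a sign pattern occur. So the convex hull is the product of a triangle and a tetrahedron, of
  dimension \<open>2 + 3\<close>. A facet of a product of two simplices is a facet of one factor times the whole
  other factor: three edges times the tetrahedron give the facets with \<open>2 \<cdot> 4 = 8\<close> vertices, and the
  triangle times four faces gives those with \<open>3 \<cdot> 3 = 9\<close> vertices.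

  The locale \<open>simplex_sum\<close> carries this out for arbitrary simplices, working with their barycentric
  coordinates as affine functionals on the ambient space. On the affine hull, the
  nonnegativity of these coordinates is an irredundant system of inequalities for the polytope, so
  that \<open>facet_of_convex_hull_iff_dual\<close> yields the facets in \<open>facet_iff\<close>; the dimension is
  \<open>aff_dim_V\<close>. For the extreme points no combinatorics is needed: all strains have the same
  Frobenius norm, and \<open>extreme_points_of_convex_hull_on_sphere\<close> applies to every set of them. In
  particular the hull of a set of strains determines the set, which gives the count of facets.
\<close>

section \<open>Extreme points, affine independence and facets of convex hulls\<close>

text \<open>A point in the open segment between two points of a ball is strictly closer to the centre than
  one of them, so a point on the sphere is never inside such a segment.\<close>

lemma extreme_points_of_convex_hull_on_sphere:
  fixes X :: "'a::euclidean_space set"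
  assumes "X \<subseteq> sphere c r"
  shows "{x. x extreme_point_of convex hull X} = X"
proof (intro equalityI subsetI CollectI)
  fix x assume x: "x \<in> X"
  have hull: "convex hull X \<subseteq> cball c r"
    using assms sphere_cball by (intro hull_minimal convex_cball) blast
  have "x \<notin> open_segment a b" if "a \<in> convex hull X" "b \<in> convex hull X" for a b
  proof
    assume "x \<in> open_segment a b"
    then have "dist c x < dist c a \<or> dist c x < dist c b"
      by (rule dist_decreases_open_segment)
    moreover have "dist c a \<le> r" "dist c b \<le> r"
      using that hull by auto
    moreover have "dist c x = r"
      using x assms by auto
    ultimately show False by linarith
  qed
  with x show "x extreme_point_of convex hull X"
    by (auto simp: extreme_point_of_def hull_inc)
qed (use extreme_points_of_convex_hull in auto)

text \<open>A hyperplane through all points of \<open>B\<close> but \<open>x\<close> contains their affine hull, hence keeps \<open>x\<close> out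
  of it.\<close>

lemma not_affine_dependent_dual:
  fixes B :: "'a::euclidean_space set"
  assumes "\<And>x. x \<in> B \<Longrightarrow> \<exists>u c. (\<forall>y\<in>B - {x}. u \<bullet> y = c) \<and> u \<bullet> x \<noteq> c"
  shows "\<not> affine_dependent B"
proof
  assume "affine_dependent B"
  then obtain x where x: "x \<in> B" "x \<in> affine hull (B - {x})"
    by (auto simp: affine_dependent_def)
  from assms[OF x(1)] obtain u c where uc: "\<forall>y\<in>B - {x}. u \<bullet> y = c" "u \<bullet> x \<noteq> c"
    by blast
  have "affine hull (B - {x}) \<subseteq> {y. u \<bullet> y = c}"
    using uc(1) by (intro hull_minimal affine_hyperplane) auto
  with x(2) uc(2) show False by auto
qed

text \<open>A criterion to read off the facets of a polytope given by its vertices from a guessed list of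
  supporting hyperplanes. Completeness says that the guessed inequalities cut the hull out of its
  affine hull; irredundancy is witnessed by points that violate exactly one inequality. A face cut
  out by a supporting hyperplane is spanned by the vertices on this hyperplane.\<close>

lemma facet_of_convex_hull_iff_dual:
  fixes V :: "'a::euclidean_space set" and a :: "'j \<Rightarrow> 'a" and b :: "'j \<Rightarrow> real"
  assumes "finite V" "finite J"
    and nonneg: "\<And>j v. j \<in> J \<Longrightarrow> v \<in> V \<Longrightarrow> 0 \<le> a j \<bullet> v + b j"
    and complete: "\<And>x. x \<in> affine hull V \<Longrightarrow> (\<And>j. j \<in> J \<Longrightarrow> 0 \<le> a j \<bullet> x + b j) \<Longrightarrow> x \<in> convex hull V"
    and irredundant: "\<And>j. j \<in> J \<Longrightarrow> \<exists>x\<in>affine hull V. a j \<bullet> x + b j < 0 \<and> (\<forall>l\<in>J - {j}. 0 \<le> a l \<bullet> x + b l)"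
  shows "F facet_of convex hull V \<longleftrightarrow> (\<exists>j\<in>J. F = convex hull {v \<in> V. a j \<bullet> v + b j = 0})"
proof -
  let ?S = "convex hull V"
  \<comment> \<open>Irredundancy makes distinct indices give distinct half-spaces, so the facets may be indexed by the
    set of half-spaces and translated back.\<close>
  define H where "H j = {x. - a j \<bullet> x \<le> b j}" for j
  have inH: "x \<in> H j \<longleftrightarrow> 0 \<le> a j \<bullet> x + b j" for x j
    by (auto simp: H_def)
  have inj: "inj_on H J"
  proof (rule inj_onI, rule ccontr)
    fix j l assume jl: "j \<in> J" "l \<in> J" "H j = H l" "j \<noteq> l"
    from irredundant[OF jl(1)] jl obtain x where "x \<notin> H j" "x \<in> H l"
      by (force simp: inH)
    with jl show False by simp
  qed
  have S_le: "0 \<le> a j \<bullet> x + b j" if "j \<in> J" "x \<in> ?S" for j x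
  proof -
    have "?S \<subseteq> H j"
      unfolding H_def using nonneg[OF that(1)]
      by (intro hull_minimal convex_halfspace_le) force
    with that inH show ?thesis by auto
  qed
  have aff: "affine hull ?S = affine hull V"
    by simp
  have S_eq: "?S = affine hull ?S \<inter> \<Inter>(H ` J)"
    unfolding aff using S_le complete convex_hull_subset_affine_hull[of V]
    by (fastforce simp: inH)
  have nonzero: "a j \<noteq> 0" if "j \<in> J" for j
  proof
    assume "a j = 0"
    from irredundant[OF that] obtain x where x: "x \<in> affine hull V" "a j \<bullet> x + b j < 0"
      by blast
    from x(1) obtain v where "v \<in> V" by (metis affine_hull_empty all_not_in_conv)
    from nonneg[OF that this] x(2) \<open>a j = 0\<close> show False by simp
  qed
  let ?j = "inv_into J H"
  have j: "?j (H j) = j" if "j \<in> J" for j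
    using inj that by simp
  have "F facet_of ?S \<longleftrightarrow>
      (\<exists>h. h \<in> H ` J \<and> F = ?S \<inter> {x. - a (?j h) \<bullet> x = b (?j h)})"
  proof (rule facet_of_polyhedron_explicit)
    show "finite (H ` J)" using assms by simp
    show "?S = affine hull ?S \<inter> \<Inter>(H ` J)" by (rule S_eq)
    show "- a (?j h) \<noteq> 0 \<and> h = {x. - a (?j h) \<bullet> x \<le> b (?j h)}" if "h \<in> H ` J" for h
      using that j nonzero by (auto simp: H_def)
    show "?S \<subset> affine hull ?S \<inter> \<Inter>F'" if F': "F' \<subset> H ` J" for F'
    proof -
      from F' obtain j where j: "j \<in> J" "H j \<notin> F'" by blast
      from irredundant[OF j(1)] obtain x where
        x: "x \<in> affine hull V" "a j \<bullet> x + b j < 0" "\<forall>l\<in>J - {j}. 0 \<le> a l \<bullet> x + b l"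
        by blast
      have "x \<in> affine hull ?S \<inter> \<Inter>F'"
        unfolding aff using x F' j by (fastforce simp: inH)
      moreover have "x \<notin> ?S"
        using S_le[OF j(1), of x] x(2) by linarith
      moreover have "?S \<subseteq> affine hull ?S \<inter> \<Inter>F'"
        using S_eq F' by blast
      ultimately show ?thesis by blast
    qed
  qed
  also have "\<dots> \<longleftrightarrow> (\<exists>j\<in>J. F = ?S \<inter> {x. - a j \<bullet> x = b j})"
    using j by force
  also have "\<dots> \<longleftrightarrow> (\<exists>j\<in>J. F = convex hull {v \<in> V. a j \<bullet> v + b j = 0})"
  proof (rule bex_cong[OF refl])
    fix j assume jJ: "j \<in> J"
    have "?S \<inter> {x. - a j \<bullet> x = b j} = convex hull {v \<in> V. a j \<bullet> v + b j = 0}"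
    proof
      have "(?S \<inter> {x. - a j \<bullet> x = b j}) face_of ?S"
        using S_le[OF jJ] by (intro face_of_Int_supporting_hyperplane_le) (auto, smt (verit))
      then obtain W where W: "W \<subseteq> V" "?S \<inter> {x. - a j \<bullet> x = b j} = convex hull W"
        using face_of_convex_hull_subset[OF finite_imp_compact[OF assms(1)]] by metis
      then have "W \<subseteq> {v \<in> V. a j \<bullet> v + b j = 0}"
        using hull_subset[of W convex] by force
      with W(2) show "?S \<inter> {x. - a j \<bullet> x = b j} \<subseteq> convex hull {v \<in> V. a j \<bullet> v + b j = 0}"
        by (simp add: hull_mono)
    next
      have "convex hull {v \<in> V. a j \<bullet> v + b j = 0} \<subseteq> {x. - a j \<bullet> x = b j}"
        by (intro hull_minimal convex_hyperplane) (auto simp: algebra_simps)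
      moreover have "convex hull {v \<in> V. a j \<bullet> v + b j = 0} \<subseteq> ?S"
        by (intro hull_mono) auto
      ultimately show "convex hull {v \<in> V. a j \<bullet> v + b j = 0} \<subseteq> ?S \<inter> {x. - a j \<bullet> x = b j}"
        by blast
    qed
    then show "(F = ?S \<inter> {x. - a j \<bullet> x = b j}) = (F = convex hull {v \<in> V. a j \<bullet> v + b j = 0})"
      by simp
  qed
  finally show ?thesis .
qed

section \<open>The Minkowski sum of two simplices in independent directions\<close>

lemma sum_scaleR_combination:
  fixes e :: "'j \<Rightarrow> 'a::real_vector"
  shows "(\<Sum>i\<in>A. (u * p i + v * q i) *\<^sub>R e i) = u *\<^sub>R (\<Sum>i\<in>A. p i *\<^sub>R e i) + v *\<^sub>R (\<Sum>i\<in>A. q i *\<^sub>R e i)"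
  by (simp add: scaleR_left_distrib sum.distrib scaleR_sum_right)

text \<open>The affine functionals \<open>x \<mapsto> a i \<bullet> x + b i\<close> and \<open>x \<mapsto> a' k \<bullet> x + b' k\<close> play the part of the barycentric
  coordinates of the two factors. Their duality to the points \<open>d i + t k\<close> encodes both that \<open>d\<close> and
  \<open>t\<close> enumerate the vertices of simplices and that these simplices lie in independent directions.\<close>

locale simplex_sum =
  fixes I :: "'i set" and K :: "'k set"
    and d :: "'i \<Rightarrow> 'a::euclidean_space" and t :: "'k \<Rightarrow> 'a"
    and a :: "'i \<Rightarrow> 'a" and b :: "'i \<Rightarrow> real"
    and a' :: "'k \<Rightarrow> 'a" and b' :: "'k \<Rightarrow> real"
  assumes finite_I: "finite I" and finite_K: "finite K"
    and card_I: "card I \<ge> 2" and card_K: "card K \<ge> 2"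
    and dual_I: "\<lbrakk>i \<in> I; j \<in> I; k \<in> K\<rbrakk> \<Longrightarrow> a i \<bullet> (d j + t k) + b i = of_bool (i = j)"
    and dual_K: "\<lbrakk>j \<in> I; k \<in> K; l \<in> K\<rbrakk> \<Longrightarrow> a' k \<bullet> (d j + t l) + b' k = of_bool (k = l)"
begin

definition verts :: "'i set \<Rightarrow> 'k set \<Rightarrow> 'a set" where
  "verts P Q = (\<lambda>(i, k). d i + t k) ` (P \<times> Q)"

abbreviation V :: "'a set" where "V \<equiv> verts I K"

lemma finite_V: "finite V"
  using finite_I finite_K by (simp add: verts_def)

lemma vertex_in_V: "\<lbrakk>i \<in> I; k \<in> K\<rbrakk> \<Longrightarrow> d i + t k \<in> V"
  by (force simp: verts_def)

text \<open>The three identities hold at the vertices by duality and are preserved under affine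
  combinations.\<close>

lemma affine_hull_coordinates:
  assumes "x \<in> affine hull V"
  shows "(\<Sum>i\<in>I. a i \<bullet> x + b i) = 1" and "(\<Sum>k\<in>K. a' k \<bullet> x + b' k) = 1"
    and "x = (\<Sum>i\<in>I. (a i \<bullet> x + b i) *\<^sub>R d i) + (\<Sum>k\<in>K. (a' k \<bullet> x + b' k) *\<^sub>R t k)"
proof -
  let ?g = "\<lambda>i x. a i \<bullet> x + b i" and ?h = "\<lambda>k x. a' k \<bullet> x + b' k"
  let ?A = "{x. (\<Sum>i\<in>I. ?g i x) = 1 \<and> (\<Sum>k\<in>K. ?h k x) = 1 \<and>
               x = (\<Sum>i\<in>I. ?g i x *\<^sub>R d i) + (\<Sum>k\<in>K. ?h k x *\<^sub>R t k)}"
  have "V \<subseteq> ?A"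
  proof
    fix x assume "x \<in> V"
    then obtain j l where x: "j \<in> I" "l \<in> K" "x = d j + t l"
      by (auto simp: verts_def)
    have g: "?g i x = of_bool (i = j)" if "i \<in> I" for i
      using x that dual_I by simp
    have h: "?h k x = of_bool (k = l)" if "k \<in> K" for k
      using x that dual_K by simp
    have "(\<Sum>i\<in>I. ?g i x) = 1" "(\<Sum>i\<in>I. ?g i x *\<^sub>R d i) = d j"
      using g x finite_I by (simp_all add: of_bool_def if_distrib [of "\<lambda>r. r *\<^sub>R _"] cong: if_cong)
    moreover have "(\<Sum>k\<in>K. ?h k x) = 1" "(\<Sum>k\<in>K. ?h k x *\<^sub>R t k) = t l"
      using h x finite_K by (simp_all add: of_bool_def if_distrib [of "\<lambda>r. r *\<^sub>R _"] cong: if_cong)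
    ultimately show "x \<in> ?A" using x(3) by simp
  qed
  moreover have "affine ?A"
    unfolding affine_def
  proof (intro ballI allI impI)
    fix x y u v assume x: "x \<in> ?A" and y: "y \<in> ?A" and uv: "u + v = (1::real)"
    let ?z = "u *\<^sub>R x + v *\<^sub>R y"
    have c: "c = u * c + v * c" for c
      using uv by (metis distrib_right mult_1)
    have g: "?g i ?z = u * ?g i x + v * ?g i y" for i
      using c[of "b i"] by (simp add: inner_simps algebra_simps)
    have h: "?h k ?z = u * ?h k x + v * ?h k y" for k
      using c[of "b' k"] by (simp add: inner_simps algebra_simps)
    have "(\<Sum>i\<in>I. ?g i ?z) = u * (\<Sum>i\<in>I. ?g i x) + v * (\<Sum>i\<in>I. ?g i y)"
      by (simp only: g sum_distrib_left) (simp only: sum.distrib)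
    then have 1: "(\<Sum>i\<in>I. ?g i ?z) = 1"
      using x y uv by (metis (mono_tags, lifting) mem_Collect_eq mult.right_neutral)
    have "(\<Sum>k\<in>K. ?h k ?z) = u * (\<Sum>k\<in>K. ?h k x) + v * (\<Sum>k\<in>K. ?h k y)"
      by (simp only: h sum_distrib_left) (simp only: sum.distrib)
    then have 2: "(\<Sum>k\<in>K. ?h k ?z) = 1"
      using x y uv by (metis (mono_tags, lifting) mem_Collect_eq mult.right_neutral)
    have x_eq: "x = (\<Sum>i\<in>I. ?g i x *\<^sub>R d i) + (\<Sum>k\<in>K. ?h k x *\<^sub>R t k)"
      and y_eq: "y = (\<Sum>i\<in>I. ?g i y *\<^sub>R d i) + (\<Sum>k\<in>K. ?h k y *\<^sub>R t k)"
      using x y by blast+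
    have "(\<Sum>i\<in>I. ?g i ?z *\<^sub>R d i) + (\<Sum>k\<in>K. ?h k ?z *\<^sub>R t k) =
        (u *\<^sub>R (\<Sum>i\<in>I. ?g i x *\<^sub>R d i) + v *\<^sub>R (\<Sum>i\<in>I. ?g i y *\<^sub>R d i)) +
        (u *\<^sub>R (\<Sum>k\<in>K. ?h k x *\<^sub>R t k) + v *\<^sub>R (\<Sum>k\<in>K. ?h k y *\<^sub>R t k))"
      by (simp only: g h sum_scaleR_combination)
    also have "\<dots> = u *\<^sub>R ((\<Sum>i\<in>I. ?g i x *\<^sub>R d i) + (\<Sum>k\<in>K. ?h k x *\<^sub>R t k)) +
        v *\<^sub>R ((\<Sum>i\<in>I. ?g i y *\<^sub>R d i) + (\<Sum>k\<in>K. ?h k y *\<^sub>R t k))"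
      by (simp only: scaleR_right_distrib add_ac)
    also have "\<dots> = ?z"
      by (simp only: x_eq [symmetric] y_eq [symmetric])
    finally show "?z \<in> ?A"
      using 1 2 by (intro CollectI conjI) (rule 1, rule 2, erule sym)
  qed
  ultimately have "affine hull V \<subseteq> ?A" by (rule hull_minimal)
  with assms show "(\<Sum>i\<in>I. ?g i x) = 1" "(\<Sum>k\<in>K. ?h k x) = 1"
    "x = (\<Sum>i\<in>I. ?g i x *\<^sub>R d i) + (\<Sum>k\<in>K. ?h k x *\<^sub>R t k)"
    by blast+
qed

text \<open>The product weights \<open>g i * h k\<close> on the vertices \<open>d i + t k\<close> are nonnegative and have sum \<open>1\<close>, and their
  marginals are the two systems of barycentric coordinates of \<open>x\<close>.\<close>

lemma convex_hull_complete:
  assumes x: "x \<in> affine hull V"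
    and "\<And>i. i \<in> I \<Longrightarrow> 0 \<le> a i \<bullet> x + b i" and "\<And>k. k \<in> K \<Longrightarrow> 0 \<le> a' k \<bullet> x + b' k"
  shows "x \<in> convex hull V"
proof -
  define g where "g i = a i \<bullet> x + b i" for i
  define h where "h k = a' k \<bullet> x + b' k" for k
  note coords = affine_hull_coordinates[OF x, folded g_def h_def]
  have "(\<Sum>(i,k)\<in>I \<times> K. (g i * h k) *\<^sub>R (d i + t k)) =
      (\<Sum>i\<in>I. \<Sum>k\<in>K. h k *\<^sub>R (g i *\<^sub>R d i)) + (\<Sum>i\<in>I. \<Sum>k\<in>K. g i *\<^sub>R (h k *\<^sub>R t k))"
    by (simp add: sum.cartesian_product [symmetric] scaleR_right_distrib sum.distrib mult.commute)
  also have "\<dots> = (\<Sum>i\<in>I. g i *\<^sub>R d i) + (\<Sum>k\<in>K. h k *\<^sub>R t k)"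
    by (simp only: scaleR_sum_left [symmetric] scaleR_sum_right [symmetric] coords(1,2) scaleR_one)
  finally have x_eq: "x = (\<Sum>p\<in>I \<times> K. (g (fst p) * h (snd p)) *\<^sub>R (d (fst p) + t (snd p)))"
    using coords(3) by (simp add: split_def)
  have "(\<Sum>p\<in>I \<times> K. g (fst p) * h (snd p)) = (\<Sum>i\<in>I. g i) * (\<Sum>k\<in>K. h k)"
    by (simp add: sum_product sum.cartesian_product split_def)
  then have "(\<Sum>p\<in>I \<times> K. g (fst p) * h (snd p)) = 1"
    using coords by simp
  then show ?thesis
    unfolding x_eq using finite_I finite_K assms(2,3) vertex_in_V
    by (intro convex_sum) (auto simp: g_def h_def intro!: hull_inc)
qed

lemma other_index:
  shows "\<exists>j\<in>I. j \<noteq> i" and "\<exists>l\<in>K. l \<noteq> k"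
proof -
  have "\<not> I \<subseteq> {i}" "\<not> K \<subseteq> {k}"
    using card_mono[of "{i}" I] card_mono[of "{k}" K] card_I card_K by auto
  then show "\<exists>j\<in>I. j \<noteq> i" "\<exists>l\<in>K. l \<noteq> k" by auto
qed

text \<open>Each barycentric coordinate vanishes exactly on the vertices that avoid its index. To violate
  one coordinate inequality and no other, extend an edge of one factor beyond the vertex with that
  index: the reflection of this vertex in the other end point has coordinates \<open>-1\<close> and \<open>2\<close> there.\<close>

lemma facet_iff:
  "F facet_of convex hull V \<longleftrightarrow>
     (\<exists>i\<in>I. F = convex hull (verts (I - {i}) K)) \<or> (\<exists>k\<in>K. F = convex hull (verts I (K - {k})))"
proof -
  let ?a = "case_sum a a'" and ?b = "case_sum b b'"
  obtain i0 k0 where i0: "i0 \<in> I" and k0: "k0 \<in> K"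
    using other_index by blast
  have reflect: "2 *\<^sub>R x - y \<in> affine hull V" if "x \<in> V" "y \<in> V" for x y
    using mem_affine_3_minus[OF affine_affine_hull hull_inc hull_inc hull_inc, of x V x y 1] that
    by (simp add: scaleR_2 add_diff_eq)
  have aff: "c \<bullet> (2 *\<^sub>R x - y) + e = 2 * (c \<bullet> x + e) - (c \<bullet> y + e)" for c x y :: 'a and e
    by (simp add: inner_simps)
  have "F facet_of convex hull V \<longleftrightarrow>
      (\<exists>j\<in>I <+> K. F = convex hull {v \<in> V. ?a j \<bullet> v + ?b j = 0})"
  proof (rule facet_of_convex_hull_iff_dual)
    show "finite V" by (rule finite_V)
    show "finite (I <+> K)" using finite_I finite_K by simp
    show "0 \<le> ?a j \<bullet> v + ?b j" if "j \<in> I <+> K" "v \<in> V" for j v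
      using that by (auto simp: verts_def dual_I dual_K)
    show "x \<in> convex hull V"
      if "x \<in> affine hull V" "\<And>j. j \<in> I <+> K \<Longrightarrow> 0 \<le> ?a j \<bullet> x + ?b j" for x
      using that(1) that(2)[OF InlI] that(2)[OF InrI] by (intro convex_hull_complete) simp_all
    show "\<exists>x\<in>affine hull V. ?a j \<bullet> x + ?b j < 0 \<and> (\<forall>l\<in>I <+> K - {j}. 0 \<le> ?a l \<bullet> x + ?b l)"
      if j: "j \<in> I <+> K" for j
    proof (cases j)
      case (Inl i)
      with j have i: "i \<in> I" by auto
      obtain i' where i': "i' \<in> I" "i' \<noteq> i" using other_index by blast
      let ?x = "2 *\<^sub>R (d i' + t k0) - (d i + t k0)"
      have "?x \<in> affine hull V"
        using i i' k0 by (intro reflect vertex_in_V)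
      moreover have "\<forall>l\<in>I <+> K - {j}. 0 \<le> ?a l \<bullet> ?x + ?b l" "?a j \<bullet> ?x + ?b j < 0"
        using i i' k0 Inl unfolding aff by (auto simp: dual_I dual_K of_bool_def simp del: distrib_left_numeral split: if_splits)
      ultimately show ?thesis by blast
    next
      case (Inr k)
      with j have k: "k \<in> K" by auto
      obtain k' where k': "k' \<in> K" "k' \<noteq> k" using other_index by blast
      let ?x = "2 *\<^sub>R (d i0 + t k') - (d i0 + t k)"
      have "?x \<in> affine hull V"
        using k k' i0 by (intro reflect vertex_in_V)
      moreover have "\<forall>l\<in>I <+> K - {j}. 0 \<le> ?a l \<bullet> ?x + ?b l" "?a j \<bullet> ?x + ?b j < 0"
        using k k' i0 Inr unfolding aff by (auto simp: dual_I dual_K of_bool_def simp del: distrib_left_numeral split: if_splits)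
      ultimately show ?thesis by blast
    qed
  qed
  moreover have "{v \<in> V. a i \<bullet> v + b i = 0} = verts (I - {i}) K" if "i \<in> I" for i
    using that dual_I[OF that] by (auto simp: verts_def image_iff; metis of_bool_eq(2) zero_neq_one)
  moreover have "{v \<in> V. a' k \<bullet> v + b' k = 0} = verts I (K - {k})" if "k \<in> K" for k
    using that dual_K by (auto simp: verts_def image_iff; metis of_bool_eq(2) zero_neq_one)
  ultimately show ?thesis
    by (auto simp: bex_Un Plus_def)
qed

text \<open>The edges leaving one vertex \<open>d i0 + t k0\<close> end in \<open>(card I - 1) + (card K - 1)\<close> further vertices.
  Together with that vertex, these points are affinely independent because each of them is
  separated from the others by an affine functional that is constant on these: a coordinate, or at
  the base vertex a sum of two. The remaining vertices complete parallelograms.\<close>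

lemma aff_dim_V: "aff_dim V = int (card I) + int (card K) - 2"
proof -
  obtain i0 k0 where i0: "i0 \<in> I" and k0: "k0 \<in> K"
    using other_index by blast
  let ?p = "\<lambda>i. d i + t k0" and ?q = "\<lambda>k. d i0 + t k"
  let ?B = "insert (d i0 + t k0) (?p ` (I - {i0}) \<union> ?q ` (K - {k0}))"
  have B_V: "?B \<subseteq> V"
    using i0 k0 by (auto intro: vertex_in_V)
  have inj_p: "inj_on ?p I"
    using dual_I[OF _ _ k0] by (intro inj_onI) (metis of_bool_eq(1) of_bool_eq(2) zero_neq_one)
  have inj_q: "inj_on ?q K"
    using dual_K[OF i0] by (intro inj_onI) (metis of_bool_eq(1) of_bool_eq(2) zero_neq_one)
  have indep: "\<not> affine_dependent ?B"
  proof (rule not_affine_dependent_dual)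
    fix x assume "x \<in> ?B"
    then consider "x = d i0 + t k0" | i where "i \<in> I - {i0}" "x = ?p i"
      | k where "k \<in> K - {k0}" "x = ?q k" by blast
    then show "\<exists>u c. (\<forall>y\<in>?B - {x}. u \<bullet> y = c) \<and> u \<bullet> x \<noteq> c"
    proof cases
      case 1
      \<comment> \<open>At the base vertex both coordinates with index \<open>i0\<close> and \<open>k0\<close> are \<open>1\<close>, at every other point of
        the basis exactly one of them is, so their sum separates.\<close>
      let ?u = "a i0 + a' k0" and ?c = "1 - b i0 - b' k0"
      have eq: "?u \<bullet> y - ?c = (a i0 \<bullet> y + b i0) + (a' k0 \<bullet> y + b' k0) - 1" for y
        by (simp add: inner_simps)
      have "?u \<bullet> y - ?c = 0" if "y \<in> ?B - {x}" for y
        using that 1 i0 k0 unfolding eq by (auto simp: dual_I dual_K)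
      moreover have "?u \<bullet> x - ?c = 1"
        using 1 i0 k0 unfolding eq by (auto simp: dual_I dual_K)
      ultimately show ?thesis
        by (intro exI[of _ ?u] exI[of _ ?c]) auto
    next
      case 2
      have eq: "(a i \<bullet> y = - b i) = (a i \<bullet> y + b i = 0)" for y by auto
      show ?thesis
        using 2 i0 k0 by (intro exI[of _ "a i"] exI[of _ "- b i"]) (unfold eq, auto simp: dual_I)
    next
      case 3
      have eq: "(a' k \<bullet> y = - b' k) = (a' k \<bullet> y + b' k = 0)" for y by auto
      show ?thesis
        using 3 i0 k0 by (intro exI[of _ "a' k"] exI[of _ "- b' k"]) (unfold eq, auto simp: dual_K)
    qed
  qed
  have "?p i \<noteq> ?q k" if "i \<in> I - {i0}" "k \<in> K" for i k
    using that dual_I[of i0 i0 k] dual_I[of i0 i k0] i0 k0 by force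
  moreover have "d i0 + t k0 \<notin> ?q ` (K - {k0})"
    using inj_q k0 by (auto dest: inj_onD)
  ultimately have "card ?B = Suc (card (?p ` (I - {i0})) + card (?q ` (K - {k0})))"
    using finite_I finite_K i0 k0
    by (subst card_insert_disjoint, force, force, subst card_Un_disjoint) force+
  also have "\<dots> = Suc ((card I - 1) + (card K - 1))"
    using inj_on_subset[OF inj_p] inj_on_subset[OF inj_q] i0 k0 by (simp add: card_image)
  finally have "int (card ?B) = int (card I) + int (card K) - 1"
    using card_I card_K by simp
  then have dim_B: "aff_dim ?B = int (card I) + int (card K) - 2"
    using aff_dim_affine_independent[OF indep] by simp
  have "d i + t k \<in> affine hull ?B" if "i \<in> I" "k \<in> K" for i k
  proof -
    have "?p i \<in> affine hull ?B" "?q k \<in> affine hull ?B" "d i0 + t k0 \<in> affine hull ?B"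
      using that by (auto intro!: hull_inc)
    from mem_affine_3_minus[OF affine_affine_hull this, of 1] show ?thesis
      by (simp add: algebra_simps)
  qed
  then have "V \<subseteq> affine hull ?B"
    by (auto simp: verts_def)
  then have "affine hull V = affine hull ?B"
    using B_V by (metis hull_hull hull_mono subset_antisym)
  with dim_B show ?thesis
    by (metis aff_dim_affine_hull)
qed


lemma inj_on_vertices: "inj_on (\<lambda>(i, k). d i + t k) (I \<times> K)"
proof (rule inj_onI, clarify)
  fix i k j l
  assume ik: "i \<in> I" "k \<in> K" "j \<in> I" "l \<in> K" and eq: "d i + t k = d j + t l"
  have "of_bool (i = j) = (1::real)" "of_bool (k = l) = (1::real)"
    using dual_I[of i i k] dual_I[of i j l] dual_K[of i k k] dual_K[of j k l] ik eq by simp_all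
  then show "i = j \<and> k = l" by simp
qed

end

section \<open>The strains as sums of a diagonal and a shear\<close>

lemma symm_mat_add:
  "symm_mat a b c p q s + symm_mat a' b' c' p' q' s' =
     symm_mat (a + a') (b + b') (c + c') (p + p') (q + q') (s + s')"
  by (simp add: symm_mat_def vec_eq_iff forall_3)

lemma symm_mat_inner:
  "symm_mat a b c p q s \<bullet> symm_mat a' b' c' p' q' s' =
     a * a' + b * b' + c * c' + 2 * (p * p' + q * q' + s * s')"
  by (simp add: symm_mat_def inner_vec_def sum_3)

definition diag_part :: "real \<Rightarrow> real \<Rightarrow> nat \<Rightarrow> real^3^3" where
  "diag_part \<alpha> \<beta> i =
     symm_mat (if i = 1 then \<beta> else \<alpha>) (if i = 2 then \<beta> else \<alpha>) (if i = 3 then \<beta> else \<alpha>) 0 0 0"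

definition shear_part :: "real \<Rightarrow> nat \<Rightarrow> real^3^3" where
  "shear_part \<delta> k =
     [symm_mat 0 0 0   \<delta>    \<delta>    \<delta>,
      symm_mat 0 0 0   \<delta>  (-\<delta>) (-\<delta>),
      symm_mat 0 0 0 (-\<delta>) (-\<delta>)   \<delta>,
      symm_mat 0 0 0 (-\<delta>)   \<delta>  (-\<delta>)] ! (k - 1)"

text \<open>Only positions \<open>1, \<dots>, 12\<close> are meaningful. The orders of the sign patterns
  differ between the three families because \<open>\<delta>\<close> occupies a different entry in each of them.\<close>

definition stretch_axis :: "nat \<Rightarrow> nat" where
  "stretch_axis n = [3, 3, 3, 3, 2, 2, 2, 2, 1, 1, 1, 1] ! (n - 1)"

definition shear_index :: "nat \<Rightarrow> nat" where
  "shear_index n = [1, 2, 3, 4, 1, 4, 3, 2, 1, 3, 4, 2] ! (n - 1)"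

lemma upto_12: "{1..12::nat} = {1, 2, 3, 4, 5, 6, 7, 8, 9, 10, 11, 12}"
  by code_simp

lemma upto_3_4: "{1..3::nat} = {1, 2, 3}" "{1..4::nat} = {1, 2, 3, 4}"
  by auto

lemma strain_decomposition:
  assumes "n \<in> {1..12}"
  shows "strain \<alpha> \<beta> \<delta> \<delta> n = diag_part \<alpha> \<beta> (stretch_axis n) + shear_part \<delta> (shear_index n)"
  using assms unfolding upto_12
  by (elim insertE emptyE)
     (simp_all add: strain_def diag_part_def shear_part_def stretch_axis_def shear_index_def symm_mat_add)

lemma bij_betw_axis_shear:
  "bij_betw (\<lambda>n. (stretch_axis n, shear_index n)) {1..12} ({1..3} \<times> {1..4})"
  unfolding bij_betw_def
proof
  show image: "(\<lambda>n. (stretch_axis n, shear_index n)) ` {1..12} = {1..3} \<times> {1..4}"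
    by code_simp
  show "inj_on (\<lambda>n. (stretch_axis n, shear_index n)) {1..12}"
    by (rule eq_card_imp_inj_on) (simp, simp only: image card_cartesian_product, simp)
qed

text \<open>The index sets are what remains after leaving out one diagonal, or one sign pattern.\<close>

lemma index_sets_8_eq: "index_sets_8 = (\<lambda>i. {n \<in> {1..12}. stretch_axis n \<noteq> i}) ` {1..3}"
  by code_simp

lemma index_sets_9_eq: "index_sets_9 = (\<lambda>k. {n \<in> {1..12}. shear_index n \<noteq> k}) ` {1..4}"
  by code_simp

text \<open>The \<open>i\<close>-th coordinate of the triangle is \<open>(x $ i $ i - \<alpha>) / (\<beta> - \<alpha>)\<close>. The tetrahedron is regular and centred
  at the origin, so its own vertices are dual to it up to scaling: two shears have inner product
  \<open>6 * \<delta>\<^sup>2\<close> if they are equal and \<open>- 2 * \<delta>\<^sup>2\<close> if not, and the factor \<open>1 / (8 * \<delta>\<^sup>2)\<close> turns these values into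
  \<open>3 / 4\<close> and \<open>- 1 / 4\<close>.\<close>

lemma simplex_sum_strains:
  assumes "\<alpha> \<noteq> \<beta>" and "\<delta> > 0"
  shows "simplex_sum {1..3} {1..4} (diag_part \<alpha> \<beta>) (shear_part \<delta>)
     (diag_part 0 (1 / (\<beta> - \<alpha>))) (\<lambda>_. - \<alpha> / (\<beta> - \<alpha>)) (shear_part (1 / (8 * \<delta>))) (\<lambda>_. 1 / 4)"
proof
  have "\<beta> / (\<beta> - \<alpha>) = 1 + \<alpha> / (\<beta> - \<alpha>)"
    using assms(1) by (simp add: field_simps)
  moreover fix i j k :: nat assume "i \<in> {1..3}" "j \<in> {1..3}" "k \<in> {1..4}"
  ultimately show "diag_part 0 (1 / (\<beta> - \<alpha>)) i \<bullet> (diag_part \<alpha> \<beta> j + shear_part \<delta> k) + - \<alpha> / (\<beta> - \<alpha>) =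
      of_bool (i = j)"
    unfolding upto_3_4
    by (elim insertE emptyE; simp add: diag_part_def shear_part_def symm_mat_add symm_mat_inner)
next
  fix j k l :: nat assume "j \<in> {1..3}" "k \<in> {1..4}" "l \<in> {1..4}"
  then show "shear_part (1 / (8 * \<delta>)) k \<bullet> (diag_part \<alpha> \<beta> j + shear_part \<delta> l) + 1 / 4 = of_bool (k = l)"
    using assms unfolding upto_3_4
    by (elim insertE emptyE; simp add: diag_part_def shear_part_def symm_mat_add symm_mat_inner)
qed simp_all

lemma strains_on_sphere:
  "strain \<alpha> \<beta> \<delta> \<delta> ` {1..12} \<subseteq> sphere 0 (sqrt (2 * \<alpha>\<^sup>2 + \<beta>\<^sup>2 + 6 * \<delta>\<^sup>2))"
  unfolding upto_12
  by (simp add: strain_def norm_eq_sqrt_inner symm_mat_inner power2_eq_square)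

section \<open>The facets of the convex hull of the strains\<close>

theorem mainTheorem4:
  fixes \<alpha> \<beta> \<delta> \<epsilon> :: real
  assumes "\<delta> > 0" and "\<epsilon> > 0"
    and "\<alpha> \<noteq> \<beta>"
    and "(\<alpha> - \<beta>) * \<delta> + \<epsilon>^2 - \<delta>^2 \<noteq> 0"
    and "\<epsilon> = \<delta>"
  shows "{F. F facet_of (convex hull (strains \<alpha> \<beta> \<delta> \<epsilon>))} =
           strain_hull \<alpha> \<beta> \<delta> \<epsilon> ` (index_sets_9 \<union> index_sets_8) \<and>
     card {F. F facet_of (convex hull (strains \<alpha> \<beta> \<delta> \<epsilon>))} = 7 \<and>
     (\<forall>F. F facet_of (convex hull (strains \<alpha> \<beta> \<delta> \<epsilon>)) \<longrightarrow> aff_dim F = 4) \<and>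
     card (strain_hull \<alpha> \<beta> \<delta> \<epsilon> ` index_sets_9) = 4 \<and>
     (\<forall>I\<in>index_sets_9. {x. x extreme_point_of (strain_hull \<alpha> \<beta> \<delta> \<epsilon> I)} = strain \<alpha> \<beta> \<delta> \<epsilon> ` I
           \<and> card {x. x extreme_point_of (strain_hull \<alpha> \<beta> \<delta> \<epsilon> I)} = 9) \<and>
     card (strain_hull \<alpha> \<beta> \<delta> \<epsilon> ` index_sets_8) = 3 \<and>
     (\<forall>I\<in>index_sets_8. {x. x extreme_point_of (strain_hull \<alpha> \<beta> \<delta> \<epsilon> I)} = strain \<alpha> \<beta> \<delta> \<epsilon> ` I
           \<and> card {x. x extreme_point_of (strain_hull \<alpha> \<beta> \<delta> \<epsilon> I)} = 8
           \<and> r0 ` I = I)"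
proof -
  let ?e = "strain \<alpha> \<beta> \<delta> \<epsilon>" and ?hull = "strain_hull \<alpha> \<beta> \<delta> \<epsilon>"
  let ?S = "convex hull (strains \<alpha> \<beta> \<delta> \<epsilon>)"
  let ?pair = "\<lambda>n. (stretch_axis n, shear_index n)"
  interpret simplex_sum "{1..3}" "{1..4}" "diag_part \<alpha> \<beta>" "shear_part \<delta>"
    "diag_part 0 (1 / (\<beta> - \<alpha>))" "\<lambda>_. - \<alpha> / (\<beta> - \<alpha>)" "shear_part (1 / (8 * \<delta>))" "\<lambda>_. 1 / 4"
    using assms by (intro simplex_sum_strains)
  have pair_image: "?pair ` {1..12} = {1..3} \<times> {1..4}"
    using bij_betw_axis_shear by (rule bij_betw_imp_surj_on)
  have e_eq: "?e n = (\<lambda>(i, k). diag_part \<alpha> \<beta> i + shear_part \<delta> k) (?pair n)" if "n \<in> {1..12}" for n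
    using strain_decomposition[OF that] assms(5) by simp
  have e_image: "?e ` N = (\<lambda>(i, k). diag_part \<alpha> \<beta> i + shear_part \<delta> k) ` (?pair ` N)"
    if "N \<subseteq> {1..12}" for N
    unfolding image_image using that e_eq by (intro image_cong) auto
  have inj: "inj_on ?e {1..12}"
  proof -
    have "inj_on ((\<lambda>(i, k). diag_part \<alpha> \<beta> i + shear_part \<delta> k) \<circ> ?pair) {1..12}"
      by (rule comp_inj_on[OF bij_betw_imp_inj_on[OF bij_betw_axis_shear]])
         (simp only: pair_image inj_on_vertices)
    then show ?thesis
      using e_eq by (subst inj_on_cong) (auto simp only: comp_def)
  qed
  have S: "strains \<alpha> \<beta> \<delta> \<epsilon> = V"
    unfolding strains_def verts_def pair_image [symmetric] by (rule e_image) simp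
  have drop_axis: "convex hull verts ({1..3} - {i}) {1..4} = ?hull {n \<in> {1..12}. stretch_axis n \<noteq> i}" for i
  proof -
    have "?pair ` {n \<in> {1..12}. stretch_axis n \<noteq> i} = ({1..3} - {i}) \<times> {1..4}"
      using pair_image by blast
    then show ?thesis by (simp only: strain_hull_def verts_def e_image Collect_restrict)
  qed
  have drop_shear: "convex hull verts {1..3} ({1..4} - {k}) = ?hull {n \<in> {1..12}. shear_index n \<noteq> k}" for k
  proof -
    have "?pair ` {n \<in> {1..12}. shear_index n \<noteq> k} = {1..3} \<times> ({1..4} - {k})"
      using pair_image by blast
    then show ?thesis by (simp only: strain_hull_def verts_def e_image Collect_restrict)
  qed
  have facets: "{F. F facet_of ?S} = ?hull ` (index_sets_9 \<union> index_sets_8)"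
    unfolding S facet_iff drop_axis drop_shear index_sets_8_eq index_sets_9_eq by blast
  have dim: "aff_dim F = 4" if "F facet_of ?S" for F
    using that aff_dim_V by (simp add: facet_of_def S aff_dim_convex_hull)
  have sub: "N \<subseteq> {1..12}" if "N \<in> index_sets_9 \<union> index_sets_8" for N
    using that unfolding index_sets_8_eq index_sets_9_eq by blast
  have extreme: "{x. x extreme_point_of ?hull N} = ?e ` N" if "N \<subseteq> {1..12}" for N
    unfolding strain_hull_def using strains_on_sphere[of \<alpha> \<beta> \<delta>] that assms(5)
    by (intro extreme_points_of_convex_hull_on_sphere) blast
  have inj_hull: "inj_on ?hull (index_sets_9 \<union> index_sets_8)"
    by (rule inj_onI) (metis extreme sub inj inj_on_image_eq_iff)
  have card_sets: "card index_sets_9 = 4" "card index_sets_8 = 3" "card (index_sets_9 \<union> index_sets_8) = 7"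
    by code_simp+
  have cards: "card N = 9" if "N \<in> index_sets_9" for N
    using that by (auto simp: index_sets_9_def)
  have cards': "card N = 8" if "N \<in> index_sets_8" for N
    using that by (auto simp: index_sets_8_def)
  have card_e: "card (?e ` N) = card N" if "N \<in> index_sets_9 \<union> index_sets_8" for N
    using inj_on_subset[OF inj sub[OF that]] by (rule card_image)
  have r0: "r0 ` N = N" if "N \<in> index_sets_8" for N
    using that by (auto simp: index_sets_8_def r0_def transpose_def)
  have "card (?hull ` index_sets_9) = 4" "card (?hull ` index_sets_8) = 3"
    "card (?hull ` (index_sets_9 \<union> index_sets_8)) = 7"
    using card_image[OF inj_on_subset[OF inj_hull]] card_sets by simp_all
  then show ?thesis
    using facets dim extreme sub card_e cards cards' r0 by simp
qed

end
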